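(* Let $\gamma\in\mathbb{C}$ with $0<|\gamma|<1$. For every integer $n\ge N_\gamma$, every $j\in\{1,\ldots,n\}$ and every $k\in\{1,\ldots,n\}$, define $$v_{\gamma,n,j,k}=(-i)^k\bigl(\sin(k s_{\gamma,n,j})+i\gamma\sin((k-1)s_{\gamma,n,j})\bigr).$$ Then the vector $v_{\gamma,n,j}=[v_{\gamma,n,j,k}]_{k=1}^n$ is an eigenvector of $A_{\gamma,n}$ associated to the eigenvalue $\lambda_{\gamma,n,j}$.
   Context: $A_{\gamma,n}$ is the $n\times n$ matrix $T_n(a)+\gamma E_{n,1,1}$, where $T_n(a)$ is the tridiagonal Toeplitz matrix with entries $(T_n(a))_{j+1,j}=1$, $(T_n(a))_{j,j+1}=-1$ and all other entries $0$, and $E_{n,1,1}$ has entry $(1,1)$ equal to $1$ and all other entries $0$. $\psi(z)=2i\cos(z)$. $\Delta_\gamma=\ln\frac{1}{|\gamma|}$. For $|\operatorname{Im}(z)|<\Delta_\gamma$, $$\vartheta_\gamma(z)=-\frac{i}{2}\ln\left(\frac{1+i\gamma e^{iz}}{1+i\gamma e^{-iz}}\right),$$ where $\ln$ is the principal branch of the logarithm on $\mathbb{C}\setminus(-\infty,0]$ (the argument of the logarithm lies in this set for all such $z$). Definition of $s_{\gamma,n,j}$ and $\lambda_{\gamma,n,j}$: put $d_{n,j}=\frac{j\pi}{n+1}$, $p_{\gamma,n,j}=d_{n,j}+\frac{\vartheta_\gamma(d_{n,j})}{n+1}$, $M_\gamma=\frac{64\sqrt{|\gamma|}}{(1-|\gamma|)^3}$,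 $N_\gamma=\frac{16}{(1-|\gamma|)^2}$, and $\mathcal{B}_{\gamma,n,j}=\{z\in\mathbb{C}\colon |z-p_{\gamma,n,j}|<M_\gamma/(n+1)^2\}$. For every integer $n\ge N_\gamma$ and $j\in\{1,\ldots,n\}$, $s_{\gamma,n,j}$ is the unique point of $\mathcal{B}_{\gamma,n,j}$ with $s_{\gamma,n,j}=\frac{j\pi}{n+1}+\frac{\vartheta_\gamma(s_{\gamma,n,j})}{n+1}$, and $\lambda_{\gamma,n,j}=\psi(s_{\gamma,n,j})$, which is an eigenvalue of $A_{\gamma,n}$. *)

theory Defs
  imports "HOL-Analysis.Complex_Transcendental" "Jordan_Normal_Form.Char_Poly"
begin

text \<open>Matrices and vectors are indexed from 0, so the mathematical entry $(r,c)$ with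
  $1 \le r, c \le n$ is stored at index $(r-1, c-1)$.\<close>

definition toeplitz_mat :: "nat \<Rightarrow> complex mat" where
  "toeplitz_mat n = mat n n (\<lambda>(r, c). if r = c + 1 then 1 else if c = r + 1 then - 1 else 0)"

definition corner_mat :: "nat \<Rightarrow> complex mat" where
  "corner_mat n = mat n n (\<lambda>(r, c). if r = 0 \<and> c = 0 then 1 else 0)"

definition A_mat :: "complex \<Rightarrow> nat \<Rightarrow> complex mat" where
  "A_mat \<gamma> n = toeplitz_mat n + \<gamma> \<cdot>\<^sub>m corner_mat n"

definition psi :: "complex \<Rightarrow> complex" where
  "psi z = 2 * \<i> * cos z"

text \<open>The function below is meant on the strip $|\mathrm{Im}\, z| < \ln (1/|\gamma|)$, where the
  argument of the logarithm avoids $(-\infty, 0]$. It is only used inside this strip: on the real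
  axis and on the balls below, which lie in the strip whenever $0 < |\gamma| < 1$,
  $n \ge N_\gamma$ and $1 \le j \le n$.\<close>

definition theta :: "complex \<Rightarrow> complex \<Rightarrow> complex" where
  "theta \<gamma> z = - (\<i> / 2) * Ln ((1 + \<i> * \<gamma> * exp (\<i> * z)) / (1 + \<i> * \<gamma> * exp (- \<i> * z)))"

definition d_pt :: "nat \<Rightarrow> nat \<Rightarrow> real" where
  "d_pt n j = real j * pi / (real n + 1)"

definition p_pt :: "complex \<Rightarrow> nat \<Rightarrow> nat \<Rightarrow> complex" where
  "p_pt \<gamma> n j = of_real (d_pt n j) + theta \<gamma> (of_real (d_pt n j)) / (of_nat n + 1)"

definition M_const :: "complex \<Rightarrow> real" where
  "M_const \<gamma> = 64 * sqrt (norm \<gamma>) / (1 - norm \<gamma>) ^ 3"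

definition N_const :: "complex \<Rightarrow> real" where
  "N_const \<gamma> = 16 / (1 - norm \<gamma>) ^ 2"

definition B_ball :: "complex \<Rightarrow> nat \<Rightarrow> nat \<Rightarrow> complex set" where
  "B_ball \<gamma> n j = {z. norm (z - p_pt \<gamma> n j) < M_const \<gamma> / (real n + 1) ^ 2}"

definition s_pt :: "complex \<Rightarrow> nat \<Rightarrow> nat \<Rightarrow> complex" where
  "s_pt \<gamma> n j = (THE s. s \<in> B_ball \<gamma> n j \<and>
     s = of_real (real j * pi / (real n + 1)) + theta \<gamma> s / (of_nat n + 1))"

definition lambda_ev :: "complex \<Rightarrow> nat \<Rightarrow> nat \<Rightarrow> complex" where
  "lambda_ev \<gamma> n j = psi (s_pt \<gamma> n j)"

definition v_entry :: "complex \<Rightarrow> nat \<Rightarrow> nat \<Rightarrow> nat \<Rightarrow> complex" where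
  "v_entry \<gamma> n j k = (- \<i>) ^ k *
     (sin (of_nat k * s_pt \<gamma> n j) + \<i> * \<gamma> * sin ((of_nat k - 1) * s_pt \<gamma> n j))"

definition v_vec :: "complex \<Rightarrow> nat \<Rightarrow> nat \<Rightarrow> complex vec" where
  "v_vec \<gamma> n j = vec n (\<lambda>i. v_entry \<gamma> n j (i + 1))"

end

theory Submission
  imports Defs
begin

text \<open>
  Away from the first and the last row, the eigenvalue equation for $A_{\gamma,n}$ is the three-term
  recurrence $f_{k-1} - f_{k+1} = \psi(s) f_k$, and for every complex $s$ the sequence
  $f_k = (-i)^k (\sin ks + i\gamma \sin (k-1)s)$ solves it because
  $\sin(w-s) + \sin(w+s) = 2\cos s \sin w$.  The two remaining rows become instances of the same
  recurrence exactly when $f_0 = \gamma f_1$ and $f_{n+1} = 0$.  The first condition is an identity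
  in $s$; the second is a quantization condition on $s$ which, written with exponentials, says
  $e^{2i(n+1)s} = (1 + i\gamma e^{is}) / (1 + i\gamma e^{-is}) = e^{2i\vartheta_\gamma(s)}$.  It
  therefore holds as soon as $(n+1)s = j\pi + \vartheta_\gamma(s)$.  The eigenvector is not zero:
  its first entry is $-i \sin s$, and if $\sin s = 0$ then $\vartheta_\gamma(s) = 0$, so that
  $s = d_{n,j}$ lies strictly between $0$ and $\pi$, where the sine does not vanish.

  What needs analysis is that the description of $s_{\gamma,n,j}$ as the unique solution of this
  equation in $\mathcal{B}_{\gamma,n,j}$ really determines a point
  (\<open>s_pt_fixed_point\<close>); this is Banach's fixed point theorem for
  $F(z) = d_{n,j} + \vartheta_\gamma(z)/(n+1)$ on the closed ball about $p = F(d_{n,j})$.  On a strip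
  $|\mathrm{Im}\, z| \le h$ with $|\gamma| e^h \le q < 1$ both factors $1 + i\gamma e^{\pm iz}$ stay
  in the right half-plane, whence $|\vartheta_\gamma'| \le q/(1-q)$
  (\<open>theta_lipschitz\<close>).  The lower bound $N_\gamma$ on $n$ makes the closed ball so small
  that it lies in the strip with $q = \sqrt{|\gamma|}$, and there $F$ is a contraction that moves the
  closed ball into the open one (\<open>strip_constants\<close>).
\<close>

section \<open>The function $\vartheta_\gamma$ on a strip\<close>

lemma one_plus_notin_nonpos_Reals:
  fixes w :: complex
  assumes "norm w < 1"
  shows "1 + w \<notin> \<real>\<^sub>\<le>\<^sub>0" and "Re (1 + w) > 0" and "norm (1 + w) \<ge> 1 - norm w"
proof -
  show "Re (1 + w) > 0"
    using abs_Re_le_cmod[of w] assms by simp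
  then show "1 + w \<notin> \<real>\<^sub>\<le>\<^sub>0"
    by (auto simp: complex_nonpos_Reals_iff)
  show "norm (1 + w) \<ge> 1 - norm w"
    using norm_diff_ineq[of 1 w] by simp
qed

text \<open>Both arguments lie in $(-\pi/2, \pi/2)$, so their difference is already the principal
  argument of the quotient.\<close>

lemma Ln_divide_right_half_plane:
  assumes "Re a > 0" and "Re b > 0"
  shows "Ln (a / b) = Ln a - Ln b"
proof -
  have nz: "a \<noteq> 0" "b \<noteq> 0" using assms by auto
  have "\<bar>Im (Ln a)\<bar> < pi / 2" "\<bar>Im (Ln b)\<bar> < pi / 2"
    using Re_Ln_pos_lt assms nz by blast+
  then have "Ln (exp (Ln a - Ln b)) = Ln a - Ln b"
    by (intro Ln_exp) auto
  then show ?thesis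
    using nz by (simp add: exp_diff)
qed

lemma norm_Ln_one_plus_le:
  assumes "norm w \<le> q" and "q < 1"
  shows "norm (Ln (1 + w)) \<le> norm w / (1 - q)"
proof -
  have "norm (Ln (1 + w) - Ln (1 + 0)) \<le> 1 / (1 - q) * norm (w - 0)"
  proof (rule field_differentiable_bound[where S = "cball 0 q" and f' = "\<lambda>w. 1 / (1 + w)"])
    fix u :: complex assume "u \<in> cball 0 q"
    then have u: "norm u \<le> q" by simp
    then have u1: "norm u < 1" using assms by simp
    show "((\<lambda>w. Ln (1 + w)) has_field_derivative 1 / (1 + u)) (at u within cball 0 q)"
      using one_plus_notin_nonpos_Reals(1)[OF u1]
      by (auto intro!: derivative_eq_intros simp: field_simps)
    have "1 - q \<le> norm (1 + u)"
      using one_plus_notin_nonpos_Reals(3)[OF u1] u by simp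
    then show "norm (1 / (1 + u)) \<le> 1 / (1 - q)"
      using assms by (simp add: norm_divide frac_le)
  next
    show "w \<in> cball 0 q" using assms by simp
    show "0 \<in> cball (0::complex) q" using assms(1) norm_ge_zero[of w] by (simp del: norm_ge_zero)
  qed simp
  then show ?thesis by simp
qed

lemma norm_exp_terms_le:
  assumes "\<bar>Im z\<bar> \<le> h" and "norm \<gamma> * exp h \<le> q"
  shows "norm (\<i> * \<gamma> * exp (\<i> * z)) \<le> q" and "norm (\<i> * \<gamma> * exp (- \<i> * z)) \<le> q"
proof -
  have "norm \<gamma> * exp (- Im z) \<le> norm \<gamma> * exp h" "norm \<gamma> * exp (Im z) \<le> norm \<gamma> * exp h"
    using assms(1) by (auto intro!: mult_left_mono)
  then show "norm (\<i> * \<gamma> * exp (\<i> * z)) \<le> q" "norm (\<i> * \<gamma> * exp (- \<i> * z)) \<le> q"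
    using assms(2) by (simp_all add: norm_mult)
qed

text \<open>Splitting the logarithm leaves two terms of the form $\mathrm{Ln}(1 + w)$ with
  $|w| \le q < 1$, which can be estimated and differentiated separately.\<close>

lemma theta_eq_diff_Ln:
  assumes "\<bar>Im z\<bar> \<le> h" and "norm \<gamma> * exp h \<le> q" and "q < 1"
  shows "theta \<gamma> z
    = - (\<i> / 2) * (Ln (1 + \<i> * \<gamma> * exp (\<i> * z)) - Ln (1 + \<i> * \<gamma> * exp (- \<i> * z)))"
proof -
  have "norm (\<i> * \<gamma> * exp (\<i> * z)) < 1" "norm (\<i> * \<gamma> * exp (- \<i> * z)) < 1"
    using norm_exp_terms_le[OF assms(1,2)] assms(3) by linarith+
  then show ?thesis
    unfolding theta_def
    by (subst Ln_divide_right_half_plane) (rule one_plus_notin_nonpos_Reals(2) refl | assumption)+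
qed

lemma norm_theta_le:
  assumes "\<bar>Im z\<bar> \<le> h" and "norm \<gamma> * exp h \<le> q" and "q < 1"
  shows "norm (theta \<gamma> z) \<le> q / (1 - q)"
proof -
  let ?a = "\<i> * \<gamma> * exp (\<i> * z)" and ?b = "\<i> * \<gamma> * exp (- \<i> * z)"
  have "norm (Ln (1 + w)) \<le> q / (1 - q)" if "norm w \<le> q" for w
    using norm_Ln_one_plus_le[OF that assms(3)] divide_right_mono[OF that, of "1 - q"] assms(3)
    by simp
  then have "norm (Ln (1 + ?a)) \<le> q / (1 - q)" "norm (Ln (1 + ?b)) \<le> q / (1 - q)"
    using norm_exp_terms_le[OF assms(1,2)] by blast+
  then have "norm (Ln (1 + ?a) - Ln (1 + ?b)) \<le> 2 * (q / (1 - q))"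
    using norm_triangle_ineq4[of "Ln (1 + ?a)" "Ln (1 + ?b)"] by linarith
  then show ?thesis
    unfolding theta_eq_diff_Ln[OF assms] norm_mult by (simp add: norm_divide mult.commute)
qed

text \<open>The derivative of $\vartheta_\gamma$ is the arithmetic mean of $u/(1+u)$ over
  $u = i\gamma e^{iz}$ and $u = i\gamma e^{-iz}$, and $|u/(1+u)| \le q/(1-q)$ for $|u| \le q$; the
  strip is convex.\<close>

lemma theta_lipschitz:
  assumes q: "norm \<gamma> * exp h \<le> q" "q < 1" and "\<bar>Im x\<bar> \<le> h" and "\<bar>Im y\<bar> \<le> h"
  shows "norm (theta \<gamma> x - theta \<gamma> y) \<le> q / (1 - q) * norm (x - y)"
proof (rule field_differentiable_bound)
  let ?S = "{z. \<bar>Im z\<bar> \<le> h}"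
  let ?A = "\<lambda>z. \<i> * \<gamma> * exp (\<i> * z)" and ?B = "\<lambda>z. \<i> * \<gamma> * exp (- \<i> * z)"
  have "?S = {z. Im z \<le> h} \<inter> {z. Im z \<ge> - h}" by auto
  then show "convex ?S"
    using convex_halfspace_Im_le convex_halfspace_Im_ge by (simp add: convex_Int)
  show "x \<in> ?S" "y \<in> ?S" using assms by auto
  fix z assume "z \<in> ?S"
  then have z: "\<bar>Im z\<bar> \<le> h" by simp
  note le = norm_exp_terms_le[OF z q(1)]
  have lt: "norm (?A z) < 1" "norm (?B z) < 1" using le q(2) by linarith+
  let ?D = "\<lambda>z. (\<i> / 2) * (\<i> * - ?A z / (1 + ?A z) - \<i> * ?B z / (1 + ?B z))"
  have "((\<lambda>z. - (\<i> / 2) * (Ln (1 + ?A z) - Ln (1 + ?B z))) has_field_derivative ?D z)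
      (at z within ?S)"
    using one_plus_notin_nonpos_Reals(1)[OF lt(1)] one_plus_notin_nonpos_Reals(1)[OF lt(2)]
    by (auto intro!: derivative_eq_intros simp: field_simps)
  then show "(theta \<gamma> has_field_derivative ?D z) (at z within ?S)"
    by (rule has_field_derivative_transform_within[where d = 1])
      (use z theta_eq_diff_Ln[OF _ q] in auto)
  have "norm (u / (1 + u)) \<le> q / (1 - q)" if "norm u \<le> q" for u :: complex
    using that q(2) one_plus_notin_nonpos_Reals(3)[of u] norm_ge_zero[of u]
    by (simp add: norm_divide frac_le del: norm_ge_zero)
  then have *: "norm (?A z / (1 + ?A z)) \<le> q / (1 - q)" "norm (?B z / (1 + ?B z)) \<le> q / (1 - q)"
    using le by blast+
  have "?D z = (?A z / (1 + ?A z) + ?B z / (1 + ?B z)) / 2"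
    by (simp add: algebra_simps add_divide_distrib)
  then have "norm (?D z) = norm (?A z / (1 + ?A z) + ?B z / (1 + ?B z)) / 2"
    by (simp add: norm_divide)
  also have "\<dots> \<le> q / (1 - q)"
    using norm_triangle_mono[OF *] by (simp add: mult.commute)
  finally show "norm (?D z) \<le> q / (1 - q)" .
qed

lemma one_plus_exp_terms_nonzero:
  assumes "\<bar>Im z\<bar> \<le> h" and "norm \<gamma> * exp h \<le> q" and "q < 1"
  shows "1 + \<i> * \<gamma> * exp (\<i> * z) \<noteq> 0" and "1 + \<i> * \<gamma> * exp (- \<i> * z) \<noteq> 0"
  using one_plus_notin_nonpos_Reals(1)[of "\<i> * \<gamma> * exp (\<i> * z)"]
    one_plus_notin_nonpos_Reals(1)[of "\<i> * \<gamma> * exp (- \<i> * z)"]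
    norm_exp_terms_le[OF assms(1,2)] assms(3) by fastforce+

lemma exp_two_i_theta:
  assumes "1 + \<i> * \<gamma> * exp (\<i> * z) \<noteq> 0" and "1 + \<i> * \<gamma> * exp (- \<i> * z) \<noteq> 0"
  shows "exp (2 * \<i> * theta \<gamma> z) * (1 + \<i> * \<gamma> * exp (- \<i> * z)) = 1 + \<i> * \<gamma> * exp (\<i> * z)"
proof -
  have "2 * \<i> * theta \<gamma> z
    = Ln ((1 + \<i> * \<gamma> * exp (\<i> * z)) / (1 + \<i> * \<gamma> * exp (- \<i> * z)))"
    by (simp add: theta_def)
  then show ?thesis using assms by (simp del: mult_minus_left)
qed

text \<open>At a zero of the sine $e^{iz} = e^{-iz}$, so the logarithm is taken at $1$.  This is what
  keeps the solutions of the fixed point equation away from the multiples of $\pi$.\<close>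

lemma theta_eq_0_if_sin_eq_0:
  assumes "sin z = 0" and "1 + \<i> * \<gamma> * exp (- \<i> * z) \<noteq> 0"
  shows "theta \<gamma> z = 0"
proof -
  have "exp (\<i> * z) = exp (- \<i> * z)"
    using assms by (simp add: sin_exp_eq)
  then show ?thesis
    using assms(2) by (simp add: theta_def)
qed

section \<open>Existence of $s_{\gamma,n,j}$\<close>

text \<open>All the arithmetic behind the constants $M_\gamma$ and $N_\gamma$, with $g = |\gamma|$ and
  $N$ in the role of $n + 1$.  The number $h$ bounds the distance from $d_{n,j}$ to any point of the
  closed ball: the first summand bounds $|p - d_{n,j}|$ and the second is the radius.  The
  conclusions after $0 \le h$ say that the strip of half-width $h$ is admissible with $q = \sqrt g$, that $F$
  contracts on it, and that $N |F(z) - p|$ stays below $N$ times the radius.  The choice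
  $q = \sqrt g$ works because $1/(1 - \sqrt g) \le 2/(1 - g)$, while $h \le 1 - \sqrt g$ leaves
  $g e^h \le \sqrt g$ by $\sqrt g \le e^{\sqrt g - 1}$.\<close>

lemma strip_constants:
  fixes g N h :: real
  assumes g: "0 < g" "g < 1" and N: "N \<ge> 16 / (1 - g)\<^sup>2"
    and h: "h = g / (1 - g) / N + 64 * sqrt g / (1 - g) ^ 3 / N\<^sup>2"
  shows "0 \<le> h" and "g * exp h \<le> sqrt g"
    and "sqrt g / (1 - sqrt g) / N < 1"
    and "sqrt g / (1 - sqrt g) * h < 64 * sqrt g / (1 - g) ^ 3 / N"
proof -
  define a where "a = sqrt g"
  define e where "e = 1 - g"
  have a: "0 < a" "a < 1" "g = a\<^sup>2" using g by (auto simp: a_def real_sqrt_lt_1_iff)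
  have e: "0 < e" "e < 1" "e = (1 - a) * (1 + a)" using g a
    by (auto simp: e_def algebra_simps power2_eq_square)
  have Npos: "N > 0" using N e g by (smt (verit) divide_pos_pos zero_less_power e_def)
  have Ne: "1 / N \<le> e\<^sup>2 / 16" using N[folded e_def] Npos e(1) by (simp add: field_simps)
  have ga: "g \<le> a" using a by (simp add: power2_eq_square)
  have h': "h = (g / e + 64 * a / e ^ 3 * (1 / N)) * (1 / N)"
    unfolding h a_def[symmetric] e_def[symmetric]
    by (simp add: power2_eq_square add_divide_distrib mult_ac)
  show "0 \<le> h" using h' a e Npos g by auto
  have "64 * a / e ^ 3 * (1 / N) \<le> 64 * a / e ^ 3 * (e\<^sup>2 / 16)"
    using Ne a e by (intro mult_left_mono) auto
  also have "\<dots> = 4 * a / e" using e by (simp add: field_simps power2_eq_square power3_eq_cube)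
  finally have "g / e + 64 * a / e ^ 3 * (1 / N) \<le> a / e + 4 * a / e"
    using ga e by (intro add_mono divide_right_mono) auto
  then have hN: "h \<le> 5 * a / e * (1 / N)"
    unfolding h' using Npos by (intro mult_right_mono) (auto simp: add_divide_distrib)
  also have "\<dots> \<le> 5 * a / e * (e\<^sup>2 / 16)"
    using Ne a e by (intro mult_left_mono) auto
  also have "\<dots> = 5 / 16 * (a * (1 + a)) * (1 - a)"
    using e by (simp add: power2_eq_square)
  also have "\<dots> \<le> 5 / 16 * 2 * (1 - a)"
    using a mult_mono[of a 1 "1 + a" 2] by (intro mult_right_mono mult_left_mono) auto
  finally have h1: "h \<le> 1 - a" using a by simp
  have "a * exp h \<le> exp (a - 1) * exp (1 - a)"
    using exp_ge_add_one_self[of "a - 1"] h1 a by (intro mult_mono) auto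
  also have "\<dots> = 1" by (simp add: exp_add[symmetric])
  finally have "a * (a * exp h) \<le> a * 1" using a by (intro mult_left_mono) auto
  then show "g * exp h \<le> sqrt g" by (simp add: a(3) a_def[symmetric] power2_eq_square mult.assoc)
  have L: "a / (1 - a) \<le> 2 * a / e"
  proof -
    have "a / (1 - a) = a * (1 + a) / e" using a e(3) by simp
    also have "\<dots> \<le> a * 2 / e"
      using a e by (intro divide_right_mono mult_left_mono) auto
    finally show ?thesis by (simp add: mult.commute)
  qed
  have "a / (1 - a) / N \<le> 2 * a / e * (e\<^sup>2 / 16)"
    using mult_mono[OF L Ne] a e Npos by simp
  also have "\<dots> = a * e / 8" using e by (simp add: power2_eq_square)
  also have "\<dots> < 1" using a e mult_mono[of a 1 e 1] by simp
  finally show "sqrt g / (1 - sqrt g) / N < 1" by (simp add: a_def)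
  have "a / (1 - a) * h \<le> (2 * a / e) * (5 * a / e * (1 / N))"
    using mult_mono[OF L hN] a e \<open>0 \<le> h\<close> by simp
  also have "\<dots> = 10 * (a * e) * (a / e ^ 3 / N)"
    using e by (simp add: field_simps power3_eq_cube)
  also have "\<dots> < 64 * (a / e ^ 3 / N)"
    using a e Npos mult_mono[of a 1 e 1] by (intro mult_strict_right_mono) auto
  finally show "sqrt g / (1 - sqrt g) * h < 64 * sqrt g / (1 - g) ^ 3 / N"
    by (simp add: a_def e_def)
qed

text \<open>Banach's theorem applies on the closed ball, since completeness is needed, whereas
  $s_{\gamma,n,j}$ is sought in the open one.  As $F$ maps the closed ball into the open ball, the
  two have the same fixed points.  The bound on the imaginary part is exported because it keeps
  $1 + i\gamma e^{\pm is}$ away from zero.\<close>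

lemma s_pt_fixed_point:
  assumes "0 < norm \<gamma>" and "norm \<gamma> < 1" and "real n \<ge> N_const \<gamma>"
  obtains h where "norm \<gamma> * exp h \<le> sqrt (norm \<gamma>)" and "\<bar>Im (s_pt \<gamma> n j)\<bar> \<le> h"
    and "s_pt \<gamma> n j = of_real (d_pt n j) + theta \<gamma> (s_pt \<gamma> n j) / (of_nat n + 1)"
proof -
  define g where "g = norm \<gamma>"
  define N where "N = real n + 1"
  define a where "a = sqrt g"
  define r where "r = M_const \<gamma> / N\<^sup>2"
  define h where "h = g / (1 - g) / N + r"
  define F where "F = (\<lambda>z. of_real (d_pt n j) + theta \<gamma> z / (of_nat n + 1))"
  define p where "p = p_pt \<gamma> n j"
  let ?d = "of_real (d_pt n j) :: complex"
  have g: "0 < g" "g < 1" using assms by (auto simp: g_def)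
  have "N \<ge> 16 / (1 - g)\<^sup>2"
    using assms(3) by (simp add: N_def N_const_def g_def)
  note const = strip_constants[OF g this, of h, folded a_def]
  have r: "r = 64 * a / (1 - g) ^ 3 / N\<^sup>2" by (simp add: r_def M_const_def a_def g_def)
  have N: "N > 0" "of_nat n + 1 = complex_of_real N" by (simp_all add: N_def)
  have a: "0 < a" "a < 1" using g by (auto simp: a_def)
  have r0: "r > 0" unfolding r using g a N by simp
  have h0: "0 \<le> h" and gh: "norm \<gamma> * exp h \<le> a" and L1: "a / (1 - a) / N < 1"
    and Lh: "a / (1 - a) * h < r * N"
    using const N by (simp_all add: h_def r g_def field_simps power2_eq_square)
  have rh: "norm (theta \<gamma> ?d / of_real N) \<le> h - r"
    using divide_right_mono[OF norm_theta_le[of ?d 0 \<gamma> g], of N] g N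
    by (simp add: h_def g_def norm_divide)
  have pd: "p = F ?d" by (simp add: p_def p_pt_def F_def)
  have near: "norm (z - ?d) \<le> h" if "z \<in> cball p r" for z
  proof -
    have "z - ?d = theta \<gamma> ?d / of_real N - (p - z)" by (simp add: pd F_def N(2))
    then show ?thesis
      using norm_triangle_ineq4[of "theta \<gamma> ?d / of_real N" "p - z"] that rh
      by (simp only: mem_cball dist_norm)
  qed
  have strip: "\<bar>Im z\<bar> \<le> h" if "z \<in> cball p r" for z
    using near[OF that] abs_Im_le_cmod[of "z - ?d"] by simp
  have FF: "norm (F x - F y) = norm (theta \<gamma> x - theta \<gamma> y) / N" for x y
    using N by (simp add: F_def norm_divide diff_divide_distrib[symmetric])
  \<comment> \<open>As $p$ is itself the value $F(d)$, the contraction estimate turns $|z - d| \le h$ into a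
    bound on $|F(z) - p|$.\<close>
  have into: "F z \<in> ball p r" if "z \<in> cball p r" for z
  proof -
    have "norm (theta \<gamma> z - theta \<gamma> ?d) \<le> a / (1 - a) * norm (z - ?d)"
      using strip[OF that] h0 by (intro theta_lipschitz[OF gh a(2)]) auto
    also have "\<dots> \<le> a / (1 - a) * h"
      using near[OF that] a by (intro mult_left_mono) auto
    finally have "norm (F z - p) < r"
      unfolding pd FF using Lh N by (simp add: field_simps)
    then show ?thesis by (simp add: dist_norm norm_minus_commute)
  qed
  have lip: "dist (F x) (F y) \<le> a / (1 - a) / N * dist x y"
    if "x \<in> cball p r" "y \<in> cball p r" for x y
    using divide_right_mono[OF theta_lipschitz[OF gh a(2) strip[OF that(1)] strip[OF that(2)]],
        of N] N
    unfolding dist_norm FF by (simp add: mult.commute)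
  have "\<exists>!z\<in>cball p r. F z = z"
    using a N L1 r0 into lip
    by (intro Banach_fix[of _ "a / (1 - a) / N"]) (auto simp: complete_eq_closed less_imp_le)
  moreover have "z \<in> ball p r \<and> z = F z \<longleftrightarrow> z \<in> cball p r \<and> F z = z" for z
    using into[of z] by auto
  ultimately have "\<exists>!z. z \<in> ball p r \<and> z = F z"
    by (simp only:)
  moreover have "B_ball \<gamma> n j = ball p r"
    by (auto simp: B_ball_def r_def N_def p_def dist_norm norm_minus_commute)
  ultimately have ex1: "\<exists>!s. s \<in> B_ball \<gamma> n j \<and>
      s = of_real (real j * pi / (real n + 1)) + theta \<gamma> s / (of_nat n + 1)"
    by (simp add: F_def d_pt_def)
  let ?s = "s_pt \<gamma> n j"
  have s: "?s \<in> B_ball \<gamma> n j" "?s = F ?s"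
    using theI'[OF ex1, folded s_pt_def] by (auto simp: F_def d_pt_def)
  then have "?s \<in> cball p r"
    by (simp add: B_ball_def r_def N_def p_def dist_norm norm_minus_commute)
  then show ?thesis
    using that gh strip s(2) by (auto simp: F_def a_def g_def)
qed

section \<open>The three-term recurrence\<close>

text \<open>The entries of the eigenvector with a free parameter $s$ and with $k$ running over all
  natural numbers, so that the fictitious entries $k = 0$ and $k = n + 1$ can express the boundary
  conditions.\<close>

definition u_seq :: "complex \<Rightarrow> complex \<Rightarrow> nat \<Rightarrow> complex" where
  "u_seq \<gamma> s k = (- \<i>) ^ k * (sin (of_nat k * s) + \<i> * \<gamma> * sin ((of_nat k - 1) * s))"

lemma u_seq_recurrence: "u_seq \<gamma> s k - u_seq \<gamma> s (k + 2) = psi s * u_seq \<gamma> s (k + 1)"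
proof -
  have sum: "sin (w - s) + sin (w + s) = 2 * cos s * sin w" for w
    by (simp add: sin_add sin_diff)
  have "u_seq \<gamma> s k - u_seq \<gamma> s (k + 2) = (- \<i>) ^ k *
    ((sin (of_nat (k + 1) * s - s) + sin (of_nat (k + 1) * s + s))
      + \<i> * \<gamma> * (sin (of_nat k * s - s) + sin (of_nat k * s + s)))"
    by (simp add: u_seq_def algebra_simps)
  also have "\<dots> = psi s * u_seq \<gamma> s (k + 1)"
    unfolding sum by (simp add: u_seq_def psi_def algebra_simps)
  finally show ?thesis .
qed

lemma u_seq_boundary_left: "u_seq \<gamma> s 0 = \<gamma> * u_seq \<gamma> s 1"
  by (simp add: u_seq_def)

text \<open>With $E = e^{i(n+1)s}$ the bracket in the entry $n + 1$, multiplied by $2i$, is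
  $E (1 + i\gamma e^{-is}) - E^{-1} (1 + i\gamma e^{is})$.  The multiple $j\pi$ disappears on
  squaring $E$.\<close>

lemma u_seq_boundary_right:
  assumes q: "exp (2 * \<i> * t) * (1 + \<i> * \<gamma> * exp (- \<i> * s)) = 1 + \<i> * \<gamma> * exp (\<i> * s)"
    and s: "(of_nat n + 1) * s = of_nat j * of_real pi + t"
  shows "u_seq \<gamma> s (n + 1) = 0"
proof -
  define E where "E = exp (\<i> * ((of_nat n + 1) * s))"
  have "E * E = exp (2 * \<i> * t) * exp (2 * of_nat j * of_real pi * \<i>)"
    unfolding E_def exp_add[symmetric] s by (simp add: algebra_simps)
  also have "exp (2 * of_nat j * of_real pi * \<i>) = 1"
    using exp_integer_2pi[of "of_nat j"] by (simp add: mult_ac)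
  finally have E2: "E * E * (1 + \<i> * \<gamma> * exp (- \<i> * s)) = 1 + \<i> * \<gamma> * exp (\<i> * s)"
    using q by simp
  have E0: "E \<noteq> 0" by (simp add: E_def)
  have "sin ((of_nat n + 1) * s) = (E - 1 / E) / (2 * \<i>)"
    by (simp add: sin_exp_eq E_def exp_minus inverse_eq_divide)
  moreover have "sin (of_nat n * s) = (E * exp (- \<i> * s) - exp (\<i> * s) / E) / (2 * \<i>)"
    unfolding E_def sin_exp_eq exp_add[symmetric] exp_diff[symmetric] 
    by (simp add: algebra_simps)
  ultimately have "2 * \<i> * (sin ((of_nat n + 1) * s) + \<i> * \<gamma> * sin (of_nat n * s)) =
      E * (1 + \<i> * \<gamma> * exp (- \<i> * s)) - (1 + \<i> * \<gamma> * exp (\<i> * s)) / E"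
    by (simp add: ring_distribs diff_divide_distrib add_divide_distrib)
  also have "\<dots> = 0"
    using E2 E0 by (simp add: field_simps)
  finally have "sin ((of_nat n + 1) * s) + \<i> * \<gamma> * sin (of_nat n * s) = 0"
    by simp
  then show ?thesis by (simp add: u_seq_def add.commute)
qed

text \<open>The two boundary values make the first and the last row look like all the others: the
  corner entry supplies the missing left neighbour $f_0$, and the missing right neighbour of the last
  entry is $f_{n+1} = 0$.\<close>

lemma A_mat_mult_eq:
  assumes n: "n \<ge> 2" and left: "f 0 = \<gamma> * f 1" and right: "f (n + 1) = 0"
    and rec: "\<And>k. f k - f (k + 2) = c * f (k + 1)"
  shows "A_mat \<gamma> n *\<^sub>v vec n (\<lambda>i. f (i + 1)) = c \<cdot>\<^sub>v vec n (\<lambda>i. f (i + 1))"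
proof (rule eq_vecI)
  let ?v = "vec n (\<lambda>i. f (i + 1))"
  fix r assume "r < dim_vec (c \<cdot>\<^sub>v ?v)"
  then have r: "r < n" by simp
  have "(A_mat \<gamma> n *\<^sub>v ?v) $ r = (\<Sum>i<n. A_mat \<gamma> n $$ (r, i) * f (i + 1))"
    using r by (simp add: A_mat_def toeplitz_mat_def corner_mat_def scalar_prod_def atLeast0LessThan)
  \<comment> \<open>Truncated subtraction makes $r - 1 = 0$ in row $0$, which is the column of the corner entry.\<close>
  also have "\<dots> = (\<Sum>i<n. (if i = r - 1 then (if r = 0 then \<gamma> * f 1 else f r) else 0)
      - (if i = r + 1 then f (r + 2) else 0))"
    using r by (intro sum.cong)
      (auto simp: A_mat_def toeplitz_mat_def corner_mat_def)
  also have "\<dots> = (if r = 0 then \<gamma> * f 1 else f r) - (if r + 1 < n then f (r + 2) else 0)"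
    using r n by (simp add: sum_subtractf)
  also have "\<dots> = f r - f (r + 2)"
    using left right r by (auto simp: not_less less_Suc_eq_le dest: le_antisym)
  finally show "(A_mat \<gamma> n *\<^sub>v ?v) $ r = (c \<cdot>\<^sub>v ?v) $ r"
    using r rec[of r] by simp
qed (simp add: A_mat_def toeplitz_mat_def corner_mat_def)

section \<open>The eigenvector\<close>

theorem theorem6:
  fixes \<gamma> :: complex and n j :: nat
  assumes "0 < norm \<gamma>" and "norm \<gamma> < 1"
    and "real n \<ge> N_const \<gamma>"
    and "j \<in> {1..n}"
  shows "eigenvector (A_mat \<gamma> n) (v_vec \<gamma> n j) (lambda_ev \<gamma> n j)"
proof -
  let ?s = "s_pt \<gamma> n j"
  obtain h where h: "norm \<gamma> * exp h \<le> sqrt (norm \<gamma>)" "\<bar>Im ?s\<bar> \<le> h"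
    and fix_s: "?s = of_real (d_pt n j) + theta \<gamma> ?s / (of_nat n + 1)"
    using s_pt_fixed_point[OF assms(1-3)] .
  have "sqrt (norm \<gamma>) < 1" using assms(2) by simp
  note nz = one_plus_exp_terms_nonzero[OF h(2,1) this]
  have "(1 - norm \<gamma>)\<^sup>2 \<le> 1"
    using assms(1,2) by (intro power_le_one) auto
  then have "N_const \<gamma> \<ge> 16"
    using assms(2) by (simp add: N_const_def field_simps)
  then have n: "n \<ge> 2" using assms(3) by linarith
  have n0: "of_nat n + 1 \<noteq> (0::complex)"
    by (metis of_nat_Suc add.commute of_nat_eq_0_iff nat.distinct(1))
  have "(of_nat n + 1) * ?s = of_nat j * of_real pi + theta \<gamma> ?s"
    by (subst fix_s) (simp add: d_pt_def ring_distribs(1) n0)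
  then have right: "u_seq \<gamma> ?s (n + 1) = 0"
    using u_seq_boundary_right exp_two_i_theta[OF nz] by blast
  have v: "v_vec \<gamma> n j = vec n (\<lambda>i. u_seq \<gamma> ?s (i + 1))"
    by (simp add: v_vec_def v_entry_def u_seq_def)
  have "sin ?s \<noteq> 0"
  proof
    assume sin0: "sin ?s = 0"
    then have "?s = of_real (d_pt n j)"
      using fix_s theta_eq_0_if_sin_eq_0[OF sin0 nz(2)] by simp
    then have "sin (d_pt n j) = 0"
      using sin0 by (metis sin_of_real of_real_eq_0_iff)
    moreover have "0 < d_pt n j" "d_pt n j < pi"
      using assms(4) mult_strict_right_mono[of "real j" "real n + 1" pi]
      by (auto simp: d_pt_def field_simps)
    ultimately show False using sin_gt_zero by force
  qed
  then have "v_vec \<gamma> n j $ 0 \<noteq> 0"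
    using n by (simp add: v u_seq_def)
  then have "v_vec \<gamma> n j \<noteq> 0\<^sub>v n"
    using n by auto
  moreover have "A_mat \<gamma> n *\<^sub>v v_vec \<gamma> n j = lambda_ev \<gamma> n j \<cdot>\<^sub>v v_vec \<gamma> n j"
    unfolding v lambda_ev_def
    by (rule A_mat_mult_eq[OF n u_seq_boundary_left right u_seq_recurrence])
  ultimately show ?thesis
    unfolding eigenvector_def
    by (simp add: v_vec_def A_mat_def toeplitz_mat_def corner_mat_def)
qed

end
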